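(* The generating function of the sequence $\{B_n^{*}(x)\}$ is given by $$F_{B^{*}}(x;z)=\sum_{n=1}^{\infty}B_n^{*}(x)z^n=-\frac12\log z-\frac12\,\psi\left(z+1/z-1-x\right).$$
   Context: The Bernoulli polynomials $B_r(x)$ are defined by the generating function $\frac{te^{xt}}{e^t-1}=\sum_{r=0}^\infty B_r(x)\frac{t^r}{r!}$. For an integer $n>0$ the Zagier polynomial is $B_n^{*}(x)=\sum_{r=0}^{n}\binom{n+r}{2r}\frac{B_r(x)}{n+r}$. $F_{B^{*}}(x;z)$ denotes the generating function $\sum_{n=1}^{\infty}B_n^{*}(x)z^n$. Here $\psi(s)=\Gamma'(s)/\Gamma(s)$ is the digamma function.
   Formalization: The series diverges for every z ≠ 0, so the equality is read as: the series is the complete asymptotic expansion of the log/digamma expression as z → 0 in any closed sector |Arg z| ≤ π−δ with 0<δ<π (principal log). *)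

theory Defs
  imports
    "HOL-Analysis.Analysis"
    "HOL-Library.Landau_Symbols"
    "HOL-Computational_Algebra.Formal_Power_Series"
begin

unbundle fps_syntax

text \<open>
  The formal power series in \<open>t\<close> given by \<open>t * exp (x * t) / (exp t - 1)\<close>. The quotient is exact,
  see \<open>bernoulli_poly_fps_mult\<close> below.
\<close>
definition bernoulli_poly_fps :: "'a :: field_char_0 \<Rightarrow> 'a fps" where
  "bernoulli_poly_fps x = fps_X * fps_exp x / (fps_exp 1 - 1)"

definition bernoulli_poly :: "nat \<Rightarrow> 'a :: field_char_0 \<Rightarrow> 'a" where
  "bernoulli_poly r x = fact r * (bernoulli_poly_fps x $ r)"

lemma bernoulli_poly_fps_mult:
  "(fps_exp 1 - 1) * bernoulli_poly_fps (x :: 'a :: field_char_0) = fps_X * fps_exp x"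
proof -
  let ?E = "fps_exp 1 - 1 :: 'a fps"
  have nth1: "?E $ 1 \<noteq> 0" by simp
  have nz: "?E \<noteq> 0" using nth1 by (metis fps_zero_nth)
  have "subdegree ?E \<le> 1" by (rule subdegree_leI[OF nth1])
  moreover have "subdegree (fps_X * fps_exp x) \<ge> 1"
    by (rule subdegree_geI) (auto simp: fps_eq_iff intro!: exI[of _ 1])
  ultimately have "?E dvd fps_X * fps_exp x"
    using nz by (simp add: fps_dvd_iff)
  thus ?thesis by (simp add: bernoulli_poly_fps_def)
qed

text \<open>The Zagier polynomials are only meaningful for \<open>n > 0\<close>.\<close>
definition zagier_poly :: "nat \<Rightarrow> 'a :: field_char_0 \<Rightarrow> 'a" where
  "zagier_poly n x =
     (\<Sum>r=0..n. of_nat ((n + r) choose (2 * r)) * (bernoulli_poly r x / of_nat (n + r)))"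

definition zagier_gen_fun :: "'a :: field_char_0 \<Rightarrow> 'a fps" where
  "zagier_gen_fun x = Abs_fps (\<lambda>n. if n = 0 then 0 else zagier_poly n x)"

text \<open>
  The coefficients \<open>zagier_poly n x\<close> grow factorially, so the generating function is in general a
  divergent series. That it is given by a function \<open>f\<close> means that it is the asymptotic expansion
  of \<open>f\<close> in the sense of Poincare, here as the argument tends to \<open>0\<close> within a set \<open>S\<close>.
\<close>
definition has_asymptotic_series :: "(complex \<Rightarrow> complex) \<Rightarrow> complex fps \<Rightarrow> complex set \<Rightarrow> bool" where
  "has_asymptotic_series f F S \<longleftrightarrow>
     (\<forall>N. (\<lambda>z. f z - (\<Sum>n<N. F $ n * z ^ n)) \<in> O[at 0 within S](\<lambda>z. z ^ N))"

text \<open>The closed sectors that avoid the branch cut of the principal logarithm.\<close>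
definition slit_sector :: "real \<Rightarrow> complex set" where
  "slit_sector \<delta> = {z. z \<noteq> 0 \<and> \<bar>Arg z\<bar> \<le> pi - \<delta>}"

end

theory Submission
  imports Defs "HOL-Complex_Analysis.Laurent_Convergence"
begin

text \<open>
  Put \<open>w = (1 - z)\<^sup>2 / z\<close>, so that the argument of the digamma function is \<open>w + 1 - x\<close>. In sectors
  avoiding the negative axis, \<open>Digamma (w + 1 - x)\<close> has the asymptotic series
  \<open>Ln w - (\<Sum>r\<ge>1. B\<^sub>r(x) / (r * w ^ r))\<close>. Indeed, let \<open>g w\<close> be the difference between the function and
  a partial sum. The relation \<open>B\<^sub>n(x) - B\<^sub>n(x - 1) = n * (x - 1) ^ (n - 1)\<close> says that
  \<open>g (w + 1) - g w\<close> is of high order in \<open>1 / w\<close>. As \<open>g (w + n)\<close> tends to \<open>0\<close> and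
  \<open>norm (w + n) \<ge> c * (norm w + n)\<close> in the sector, summing the increments bounds \<open>g w\<close>.
  Finally \<open>1 / w = z / (1 - z)\<^sup>2\<close> and \<open>Ln z + Ln w = 2 * Ln (1 - z)\<close>, so substituting and expanding
  the powers of \<open>1 / w\<close> by the binomial series gives the Zagier polynomials as coefficients.
\<close>

unbundle no vec_syntax

section \<open>Convergent power series and their truncation errors\<close>

text \<open>Removing the first \<open>N\<close> terms leaves a series divisible by
  \<open>z ^ N\<close>. The quotient again has a power series expansion, hence is continuous and so
  bounded near 0.\<close>

lemma has_fps_expansion_imp_bigo:
  fixes f :: "complex \<Rightarrow> complex"
  assumes "f has_fps_expansion F"
  shows "(\<lambda>z. f z - (\<Sum>n<N. F $ n * z ^ n)) \<in> O[at 0](\<lambda>z. z ^ N)"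
proof -
  define g where "g z = f z - (\<Sum>n<N. F $ n * z ^ n)" for z
  define G where "G = F - (\<Sum>n<N. fps_const (F $ n) * fps_X ^ n)"
  have G0: "G $ k = 0" if "k < N" for k
    using that by (simp add: G_def fps_sum_nth fps_X_power_nth if_distrib cong: if_cong)
  have gG: "g has_fps_expansion G"
    unfolding g_def G_def by (intro fps_expansion_intros assms)
  define h where "h = (\<lambda>z. if z = 0 then G $ N else g z / z ^ N)"
  \<comment> \<open>The zero series has \<open>subdegree\<close> 0 by convention, so vanishing
    coefficients bound the subdegree from below only when \<open>G\<close> is nonzero.\<close>
  have "h has_fps_expansion fps_shift N G \<or> G = 0"
    unfolding h_def using gG G0 by (metis has_fps_expansion_shift subdegree_geI)
  then show "g \<in> O[at 0](\<lambda>z. z ^ N)"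
  proof
    assume "h has_fps_expansion fps_shift N G"
    then have "continuous (at 0) h"
      by (rule has_fps_expansion_imp_continuous)
    then have "h \<in> O[at 0](\<lambda>_. 1)"
      by (intro continuous_imp_bigo_1) simp
    then have "(\<lambda>z. h z * z ^ N) \<in> O[at 0](\<lambda>z. 1 * z ^ N)"
      by (intro landau_o.big.mult) auto
    moreover have "\<forall>\<^sub>F z in at 0. h z * z ^ N = g z"
      by (auto simp: h_def eventually_at_filter)
    ultimately show ?thesis
      using landau_o.big.in_cong[of "\<lambda>z. h z * z ^ N" g "at 0"] by simp
  next
    assume "G = 0"
    then have "\<forall>\<^sub>F z in nhds 0. g z = 0"
      using gG by (auto simp: has_fps_expansion_def)
    then have "\<forall>\<^sub>F z in at 0. g z = 0"
      by (simp add: eventually_at_filter eventually_mono)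
    then show ?thesis
      using landau_o.big.in_cong[of g "\<lambda>_. 0" "at 0"] by simp
  qed
qed

text \<open>Division by zero yields 0, so the coefficient at index 0 is 0, in agreement with
  \<open>ln 1 = 0\<close>. The same convention is at work in the expansion of
  \<open>ln (1 + z)\<close>.\<close>

lemma has_fps_expansion_ln_one_minus:
  "(\<lambda>z. ln (1 - z :: complex)) has_fps_expansion Abs_fps (\<lambda>n. - 1 / of_nat n)"
proof (rule has_fps_expansionI)
  have "\<forall>\<^sub>F u :: complex in nhds 0. u \<in> ball 0 1"
    by (intro eventually_nhds_in_open) auto
  then show "\<forall>\<^sub>F u :: complex in nhds 0. (\<lambda>n. Abs_fps (\<lambda>n. - 1 / of_nat n) $ n * u ^ n) sums ln (1 - u)"
    by eventually_elim (use Ln_series'[of "- u" for u] in auto)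
qed

lemma has_fps_expansion_ln_one_plus:
  "(\<lambda>z. ln (1 + z :: complex)) has_fps_expansion Abs_fps (\<lambda>n. - ((- 1) ^ n) / of_nat n)"
proof (rule has_fps_expansionI)
  have "\<forall>\<^sub>F u :: complex in nhds 0. u \<in> ball 0 1"
    by (intro eventually_nhds_in_open) auto
  then show "\<forall>\<^sub>F u :: complex in nhds 0. (\<lambda>n. Abs_fps (\<lambda>n. - ((- 1) ^ n) / of_nat n) $ n * u ^ n) sums ln (1 + u)"
  proof eventually_elim
    case (elim u)
    then show ?case
      using Ln_series'[of u] by (simp add: power_minus[of u])
  qed
qed

text \<open>The negative binomial series, shifted by \<open>r\<close>. One form covers
  \<open>(u / (1 + u)) ^ r\<close>, \<open>u / (1 + (1 - x) * u)\<close> and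
  \<open>(z / (1 - z) ^ 2) ^ r\<close>.\<close>

lemma has_fps_expansion_power_quotient:
  fixes c :: complex
  assumes "s > 0"
  shows "(\<lambda>z. z ^ r * inverse ((1 - c * z) ^ s)) has_fps_expansion
           Abs_fps (\<lambda>n. if n < r then 0 else of_nat ((s + (n - r) - 1) choose (n - r)) * c ^ (n - r))"
proof -
  have "(\<lambda>z. z ^ r * inverse ((1 - c * z) ^ s)) has_fps_expansion
          fps_X ^ r * inverse ((1 - fps_const c * fps_X) ^ s)"
    by (intro fps_expansion_intros) (simp add: fps_nth_power_0)
  also have "fps_X ^ r * inverse ((1 - fps_const c * fps_X) ^ s) =
      Abs_fps (\<lambda>n. if n < r then 0 else of_nat ((s + (n - r) - 1) choose (n - r)) * c ^ (n - r))"
    using assms by (intro fps_ext) (simp add: one_minus_const_fps_X_neg_power' fps_X_power_mult_nth)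
  finally show ?thesis .
qed

section \<open>Bernoulli polynomials and their difference equation\<close>

lemma bernoulli_poly_0 [simp]: "bernoulli_poly 0 x = 1"
proof -
  have "((fps_exp 1 - 1) * bernoulli_poly_fps x) $ 1 = (fps_X * fps_exp x) $ 1"
    by (simp add: bernoulli_poly_fps_mult)
  then show ?thesis
    by (simp add: fps_mult_nth bernoulli_poly_def)
qed

text \<open>The left side is the expansion of \<open>B_n(x - 1)\<close> in powers of the shift.
  Multiplying (e^t - 1) B = t e^(xt) by e^(-t) gives B e^(-t) = B - t e^((x-1)t), and the
  coefficients of t^n are compared.\<close>

lemma bernoulli_poly_translate:
  fixes x :: "'a :: field_char_0"
  assumes "n > 0"
  shows "(\<Sum>r\<le>n. of_nat (n choose r) * (- 1) ^ (n - r) * bernoulli_poly r x) =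
           bernoulli_poly n x - of_nat n * (x - 1) ^ (n - 1)"
proof -
  let ?B = "bernoulli_poly_fps x"
  have "fps_exp (- 1) * ((fps_exp 1 - 1) * ?B) = fps_exp (- 1) * (fps_X * fps_exp x)"
    by (simp only: bernoulli_poly_fps_mult)
  moreover have "fps_exp (- 1) * fps_exp (1::'a) = 1"
    using fps_exp_add_mult[of "-1" "1::'a"] by simp
  moreover have "fps_exp (- 1) * fps_exp x = fps_exp (x - 1)"
    using fps_exp_add_mult[of "-1" x] by simp
  ultimately have "?B * fps_exp (- 1) = ?B - fps_X * fps_exp (x - 1)"
    by (simp add: algebra_simps)
  then have "(?B * fps_exp (- 1)) $ n = (?B - fps_X * fps_exp (x - 1)) $ n"
    by simp
  then have "(\<Sum>r\<le>n. ?B $ r * ((- 1) ^ (n - r) / fact (n - r))) = ?B $ n - (x - 1) ^ (n - 1) / fact (n - 1)"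
    using assms by (simp add: fps_mult_nth[of ?B "fps_exp (- 1)"] atLeast0AtMost)
  then have "fact n * (\<Sum>r\<le>n. ?B $ r * ((- 1) ^ (n - r) / fact (n - r))) =
      fact n * ?B $ n - fact n * ((x - 1) ^ (n - 1) / fact (n - 1))"
    by (simp only: right_diff_distrib)
  also have "fact n * ((x - 1) ^ (n - 1) / fact (n - 1)) = of_nat n * (x - 1) ^ (n - 1)"
    using assms by (simp add: fact_reduce)
  also have "fact n * (\<Sum>r\<le>n. ?B $ r * ((- 1) ^ (n - r) / fact (n - r))) =
      (\<Sum>r\<le>n. of_nat (n choose r) * (- 1) ^ (n - r) * bernoulli_poly r x)"
    by (auto simp: sum_distrib_left bernoulli_poly_def binomial_fact intro!: sum.cong)
  finally show ?thesis
    by (simp add: bernoulli_poly_def)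
qed

text \<open>
  With \<open>u = 1 / w\<close>, this is the increment under \<open>w \<mapsto> w + 1\<close> of the truncated asymptotic series
  of \<open>Digamma (w + 1 - x)\<close>, minus the increment \<open>1 / (w + 1 - x)\<close> of the function itself.
\<close>
lemma bernoulli_increment_bigo:
  fixes x :: complex
  shows "(\<lambda>u. ln (1 + u)
            - (\<Sum>r\<in>{1..M}. bernoulli_poly r x / of_nat r * ((u / (1 + u)) ^ r - u ^ r))
            - u / (1 + (1 - x) * u)) \<in> O[at 0](\<lambda>u. u ^ Suc M)"
proof -
  define b where "b r = bernoulli_poly r x / of_nat r" for r
  define T where "T u = ln (1 + u)
      - (\<Sum>r\<in>{1..M}. b r * (u ^ r * inverse ((1 - (- 1) * u) ^ r) - u ^ r))
      - u ^ 1 * inverse ((1 - (x - 1) * u) ^ 1)" for u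
  \<comment> \<open>\<open>Q c r s\<close> is the expansion of
    \<open>z ^ r / (1 - c * z) ^ s\<close>; the quotients in \<open>T\<close> are written in this
    shape.\<close>
  define Q where "Q c r s = Abs_fps (\<lambda>n. if n < r then 0
      else of_nat ((s + (n - r) - 1) choose (n - r)) * c ^ (n - r))" for c :: complex and r s :: nat
  define F where "F = Abs_fps (\<lambda>n. - ((- 1) ^ n) / of_nat n)
      - (\<Sum>r\<in>{1..M}. fps_const (b r) * (Q (- 1) r r - fps_X ^ r)) - Q (x - 1) 1 1"
  have "T has_fps_expansion F"
    unfolding T_def F_def Q_def
    by (intro has_fps_expansion_diff has_fps_expansion_ln_one_plus has_fps_expansion_sum
        has_fps_expansion_cmult_left has_fps_expansion_power_quotient has_fps_expansion_fps_X_power) auto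
  \<comment> \<open>After multiplication by \<open>n\<close>, the vanishing of the coefficient for
    \<open>n > 0\<close> is the translation identity for the n-th Bernoulli polynomial.\<close>
  moreover have "F $ n = 0" if "n < Suc M" for n
  proof (cases "n = 0")
    case True
    then show ?thesis
      by (auto simp: F_def Q_def fps_sum_nth intro!: sum.neutral)
  next
    case n: False
    \<comment> \<open>The absorption identity
      \<open>r * (n choose r) = n * ((n - 1) choose (r - 1))\<close> cancels the denominator
      \<open>r\<close> in \<open>b r\<close>.\<close>
    have Q_eq: "of_nat n * (b r * Q (- 1) r r $ n) = of_nat (n choose r) * (- 1) ^ (n - r) * bernoulli_poly r x"
      if "r \<ge> 1" "r \<le> n" for r
    proof -
      have "r + (n - r) - 1 = n - 1"
        using that by simp
      moreover have "(n - 1) choose (n - r) = (n - 1) choose (r - 1)"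
        using that binomial_symmetric[of "n - r" "n - 1"] by simp
      moreover have "r * (n choose r) = n * ((n - 1) choose (r - 1))"
        using that by (simp add: times_binomial_minus1_eq)
      then have "of_nat r * of_nat (n choose r) = (of_nat n * of_nat ((n - 1) choose (r - 1)) :: complex)"
        by (metis of_nat_mult)
      ultimately show ?thesis
        using that by (simp add: Q_def b_def field_simps)
    qed
    have "F $ n = - ((- 1) ^ n) / of_nat n
        - (\<Sum>r\<in>{1..M}. b r * (Q (- 1) r r $ n - (if n = r then 1 else 0))) - (x - 1) ^ (n - 1)"
      using n by (simp add: F_def Q_def fps_sum_nth)
    \<comment> \<open>\<open>Q (- 1) r r\<close> starts in degree \<open>r\<close>, so summands with
      \<open>r > n\<close> vanish; of the monomials only the one with \<open>r = n\<close>
      contributes.\<close>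
    also have "(\<Sum>r\<in>{1..M}. b r * (Q (- 1) r r $ n - (if n = r then 1 else 0))) =
        (\<Sum>r\<in>{1..n}. b r * Q (- 1) r r $ n) - b n"
    proof -
      have "(\<Sum>r\<in>{1..M}. b r * Q (- 1) r r $ n) = (\<Sum>r\<in>{1..n}. b r * Q (- 1) r r $ n)"
        using \<open>n < Suc M\<close> by (intro sum.mono_neutral_right) (auto simp: Q_def)
      moreover have "(\<Sum>r\<in>{1..M}. b r * (if n = r then 1 else 0)) = b n"
        using \<open>n < Suc M\<close> n by (simp add: if_distrib sum.delta' cong: if_cong)
      ultimately show ?thesis
        by (simp add: right_diff_distrib sum_subtractf)
    qed
    finally have "of_nat n * F $ n = - ((- 1) ^ n)
        - (\<Sum>r\<in>{1..n}. of_nat n * (b r * Q (- 1) r r $ n)) + of_nat n * b n - of_nat n * (x - 1) ^ (n - 1)"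
      using n by (simp add: ring_distribs sum_distrib_left)
    also have "(\<Sum>r\<in>{1..n}. of_nat n * (b r * Q (- 1) r r $ n)) =
        (\<Sum>r\<in>{1..n}. of_nat (n choose r) * (- 1) ^ (n - r) * bernoulli_poly r x)"
      by (intro sum.cong refl Q_eq) auto
    \<comment> \<open>The summand \<open>(- 1) ^ n\<close> for \<open>r = 0\<close> cancels against
      the coefficient of the logarithm.\<close>
    also have "\<dots> = (\<Sum>r\<le>n. of_nat (n choose r) * (- 1) ^ (n - r) * bernoulli_poly r x) - (- 1) ^ n"
      by (simp add: atMost_atLeast0 sum.atLeast_Suc_atMost)
    also have "of_nat n * b n = bernoulli_poly n x"
      using n by (simp add: b_def)
    finally have "of_nat n * F $ n = 0"
      using n by (simp add: bernoulli_poly_translate)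
    then show ?thesis
      using n by simp
  qed
  ultimately have "T \<in> O[at 0](\<lambda>u. u ^ Suc M)"
    using has_fps_expansion_imp_bigo[of T F "Suc M"] by simp
  moreover have "T = (\<lambda>u. ln (1 + u)
            - (\<Sum>r\<in>{1..M}. bernoulli_poly r x / of_nat r * ((u / (1 + u)) ^ r - u ^ r))
            - u / (1 + (1 - x) * u))"
    by (auto simp: T_def b_def fun_eq_iff divide_inverse power_mult_distrib power_inverse algebra_simps)
  ultimately show ?thesis by simp
qed

section \<open>Geometry of the slit sectors\<close>

text \<open>Cosine is decreasing on [0, pi] and \<open>cos (Arg z) = Re z / norm z\<close>. Without
  \<open>Arg\<close>, the effect of a real shift is easy to control.\<close>

lemma mem_slit_sector_iff:
  assumes "0 < \<delta>" "\<delta> < pi"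
  shows "z \<in> slit_sector \<delta> \<longleftrightarrow> z \<noteq> 0 \<and> Re z + cos \<delta> * norm z \<ge> 0"
proof (cases "z = 0")
  case False
  have "\<bar>Arg z\<bar> \<le> pi - \<delta> \<longleftrightarrow> cos (pi - \<delta>) \<le> cos \<bar>Arg z\<bar>"
    using assms Arg_bounded[of z] by (intro cos_mono_le_eq[symmetric]) auto
  also have "\<dots> \<longleftrightarrow> - cos \<delta> \<le> Re z / norm z"
    using False by (simp add: cos_Arg)
  also have "\<dots> \<longleftrightarrow> Re z + cos \<delta> * norm z \<ge> 0"
    using False by (simp add: field_simps) linarith
  finally show ?thesis
    using False by (simp add: slit_sector_def)
qed (simp add: slit_sector_def)

lemma slit_sector_shift:
  assumes "0 < \<delta>" "\<delta> < pi"
  obtains c where "c > 0"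
    and "\<And>w t. w \<in> slit_sector \<delta> \<Longrightarrow> t \<ge> 0 \<Longrightarrow> norm (w + of_real t) \<ge> c * (norm w + t)"
    and "\<And>w t. w \<in> slit_sector \<delta> \<Longrightarrow> t \<ge> 0 \<Longrightarrow> w + of_real t \<in> slit_sector \<delta>"
proof -
  define k where "k = cos \<delta>"
  have k: "k < 1" "k \<ge> - 1"
    using cos_monotone_0_pi[of 0 \<delta>] assms by (auto simp: k_def)
  \<comment> \<open>This is \<open>sin (\<delta> / 2)\<close>. It comes from a^2 + t^2 - 2kat =
    (1-k)/2 (a+t)^2 + (1+k)/2 (a-t)^2 with a = \<open>norm w\<close>, where the left side bounds
    \<open>(norm (w + t))\<^sup>2\<close> from below.\<close>
  define c where "c = sqrt ((1 - k) / 2)"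
  have "c > 0"
    using k by (simp add: c_def)
  have lower: "norm (w + of_real t) \<ge> c * (norm w + t)" if w: "w \<in> slit_sector \<delta>" and t: "t \<ge> 0" for w t
  proof (rule power2_le_imp_le)
    have "(c * (norm w + t))\<^sup>2 = (1 - k) / 2 * (norm w + t)\<^sup>2"
      using k by (simp add: c_def power_mult_distrib)
    also have "\<dots> \<le> (1 - k) / 2 * (norm w + t)\<^sup>2 + (1 + k) / 2 * (norm w - t)\<^sup>2"
      using k by simp
    also have "\<dots> = (norm w)\<^sup>2 + t\<^sup>2 - 2 * t * (k * norm w)"
      by (simp add: power2_eq_square field_simps)
    also have "\<dots> \<le> (norm w)\<^sup>2 + t\<^sup>2 + 2 * t * Re w"
    proof -
      have "t * (- (k * norm w)) \<le> t * Re w"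
        using w t assms by (intro mult_left_mono) (auto simp: mem_slit_sector_iff k_def)
      then show ?thesis by (simp add: algebra_simps)
    qed
    also have "\<dots> = (norm (w + of_real t))\<^sup>2"
      unfolding cmod_power2 by (simp add: power2_eq_square algebra_simps)
    finally show "(c * (norm w + t))\<^sup>2 \<le> (norm (w + of_real t))\<^sup>2" .
  qed simp
  have "w + of_real t \<in> slit_sector \<delta>" if w: "w \<in> slit_sector \<delta>" and t: "t \<ge> 0" for w t
  proof -
    have w': "w \<noteq> 0" "Re w + k * norm w \<ge> 0"
      using w assms by (auto simp: mem_slit_sector_iff k_def)
    have "0 < c * (norm w + t)"
      using \<open>c > 0\<close> w' t by (simp add: add_pos_nonneg)
    then have "w + of_real t \<noteq> 0"
      using lower[OF w t] by auto
    \<comment> \<open>The shift adds \<open>t\<close> to the real part, while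
      \<open>k * norm w\<close> changes by at most \<open>t\<close> because
      \<open>\<bar>k\<bar> \<le> 1\<close>.\<close>
    moreover have "- t \<le> k * (norm (w + of_real t) - norm w)"
    proof -
      have "\<bar>norm (w + of_real t) - norm w\<bar> \<le> t"
        using norm_triangle_ineq3[of "w + of_real t" w] t by simp
      then have "\<bar>k\<bar> * \<bar>norm (w + of_real t) - norm w\<bar> \<le> 1 * t"
        using k by (intro mult_mono) auto
      then show ?thesis
        by (simp add: abs_mult [symmetric])
    qed
    ultimately show ?thesis
      using w' assms by (simp add: mem_slit_sector_iff k_def algebra_simps)
  qed
  with \<open>c > 0\<close> lower that show ?thesis by blast
qed

section \<open>Asymptotic expansion of the digamma function\<close>

text \<open>Iterating the recurrence reduces this to the limit formula for \<open>Digamma s\<close>.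
  The term \<open>ln n\<close> is a common yardstick for \<open>Digamma\<close> and
  \<open>Ln\<close> along \<open>w + n\<close>.\<close>

lemma Digamma_shift_minus_ln_tendsto:
  fixes s :: complex
  assumes "\<And>n. s + of_nat n \<noteq> 0"
  shows "(\<lambda>n. Digamma (s + of_nat n) - of_real (ln (real n))) \<longlonglongrightarrow> 0"
proof -
  have s: "s \<noteq> 0" using assms[of 0] by simp
  have shift: "Digamma (s + of_nat n) = Digamma s + (\<Sum>k<n. inverse (s + of_nat k))" for n
  proof (induction n)
    case (Suc n)
    have "Digamma (s + of_nat n + 1) = Digamma (s + of_nat n) + 1 / (s + of_nat n)"
      by (rule Digamma_plus1) (rule assms)
    then show ?case
      using Suc by (simp add: add_ac inverse_eq_divide)
  qed simp
  have "(\<lambda>n. Digamma s - (of_real (ln (real n)) - (\<Sum>k<n. inverse (s + of_nat k)))) \<longlonglongrightarrow> Digamma s - Digamma s"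
    by (intro tendsto_diff tendsto_const Digamma_LIMSEQ s)
  then show ?thesis
    by (simp add: shift algebra_simps)
qed

text \<open>A positive real factor \<open>n\<close> splits off the principal logarithm exactly,
  leaving \<open>Ln (1 + w / n)\<close>.\<close>

lemma Ln_shift_minus_ln_tendsto:
  fixes w :: complex
  assumes "\<And>n. w + of_nat n \<noteq> 0"
  shows "(\<lambda>n. Ln (w + of_nat n) - of_real (ln (real n))) \<longlonglongrightarrow> 0"
proof -
  have "(\<lambda>n. w / of_nat n) \<longlonglongrightarrow> 0"
    by (rule lim_const_over_n)
  then have "(\<lambda>n. Ln (1 + w / of_nat n)) \<longlonglongrightarrow> Ln (1 + 0)"
    by (intro tendsto_intros) auto
  moreover have "\<forall>\<^sub>F n in sequentially. Ln (1 + w / of_nat n) = Ln (w + of_nat n) - of_real (ln (real n))"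
    using eventually_gt_at_top[of 0]
  proof eventually_elim
    case (elim n)
    have "w + of_nat n = of_real (real n) * (1 + w / of_nat n)"
      using elim by (simp add: field_simps)
    moreover from this assms[of n] have "1 + w / of_nat n \<noteq> 0"
      by auto
    ultimately show ?case
      using elim Ln_times_of_real[of "real n" "1 + w / of_nat n"] by simp
  qed
  ultimately show ?thesis
    by (simp add: Lim_transform_eventually)
qed

text \<open>Summing up to \<open>Suc N\<close> makes the increments of order \<open>N + 2\<close> in
  \<open>1 / w\<close>: along \<open>w + n\<close>, \<open>N\<close> factors give the decay in
  \<open>w\<close> and two make the sum over \<open>n\<close> converge.\<close>

lemma Digamma_asymptotic_expansion:
  fixes x :: complex
  assumes \<delta>: "0 < \<delta>" "\<delta> < pi"
  obtains C R where "C \<ge> 0" "R > 0"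
    and "\<And>w. w \<in> slit_sector \<delta> \<Longrightarrow> norm w \<ge> R \<Longrightarrow>
           norm (Digamma (w + 1 - x)
             - (Ln w - (\<Sum>r\<in>{1..Suc N}. bernoulli_poly r x / of_nat r * (1 / w) ^ r)))
           \<le> C * norm (1 / w) ^ N"
proof -
  define b where "b r = bernoulli_poly r x / of_nat r" for r
  define g where "g w = Digamma (w + 1 - x) - (Ln w - (\<Sum>r\<in>{1..Suc N}. b r * (1 / w) ^ r))" for w
  define T where "T u = ln (1 + u) - (\<Sum>r\<in>{1..Suc N}. b r * ((u / (1 + u)) ^ r - u ^ r))
      - u / (1 + (1 - x) * u)" for u
  have "T \<in> O[at 0](\<lambda>u. u ^ (N + 2))"
    using bernoulli_increment_bigo[of x "Suc N"] by (simp add: T_def[abs_def] b_def)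
  then obtain C0 where C0: "C0 > 0" "\<forall>\<^sub>F u in at 0. norm (T u) \<le> C0 * norm (u ^ (N + 2))"
    by (elim landau_o.bigE)
  \<comment> \<open>The sector leaves room \<open>\<delta>\<close> up to the cut, so
    \<open>Ln (v * (1 + u))\<close> splits additively once the argument of \<open>1 + u\<close> is
    below \<open>\<delta>\<close>.\<close>
  have "((\<lambda>u. Im (Ln (1 + u))) \<longlongrightarrow> Im (Ln (1 + 0))) (at 0)"
    by (intro tendsto_intros) auto
  then have "\<forall>\<^sub>F u in at 0. dist (Im (Ln (1 + u))) 0 < \<delta>"
    using \<delta> by (intro tendstoD) auto
  with C0(2) have "\<forall>\<^sub>F u in at 0. norm (T u) \<le> C0 * norm u ^ (N + 2) \<and> \<bar>Im (Ln (1 + u))\<bar> < \<delta>"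
    by eventually_elim (auto simp: norm_mult norm_power)
  then obtain \<rho>' where \<rho>': "\<rho>' > 0"
      "\<And>u. u \<noteq> 0 \<Longrightarrow> norm u < \<rho>' \<Longrightarrow> norm (T u) \<le> C0 * norm u ^ (N + 2) \<and> \<bar>Im (Ln (1 + u))\<bar> < \<delta>"
    unfolding eventually_at by auto
  \<comment> \<open>The cap at 1 ensures \<open>1 + u \<noteq> 0\<close> for
    \<open>norm u < \<rho>\<close>.\<close>
  define \<rho> where "\<rho> = min 1 \<rho>'"
  have \<rho>: "\<rho> > 0" "\<rho> \<le> 1" "\<rho> \<le> \<rho>'"
    using \<rho>'(1) by (auto simp: \<rho>_def)
  obtain c where c: "c > 0"
    and lower: "\<And>w t. w \<in> slit_sector \<delta> \<Longrightarrow> t \<ge> 0 \<Longrightarrow> norm (w + of_real t) \<ge> c * (norm w + t)"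
    and shift: "\<And>w t. w \<in> slit_sector \<delta> \<Longrightarrow> t \<ge> 0 \<Longrightarrow> w + of_real t \<in> slit_sector \<delta>"
    using slit_sector_shift[OF \<delta>] by metis
  \<comment> \<open>For \<open>norm v \<ge> c * R\<close> this gives
    \<open>norm (1 / v) < \<rho>\<close> and \<open>v + 1 - x \<noteq> 0\<close>. The threshold
    carries the factor \<open>c\<close> because a shift of \<open>w\<close> may shrink its norm by
    that factor.\<close>
  define R where "R = 1 + (1 / \<rho> + norm x + 1) / c"
  have R: "R \<ge> 1" "c * R > 1 / \<rho> + norm x + 1"
    using c \<rho> by (auto simp: R_def field_simps)

  \<comment> \<open>With \<open>u = 1 / v\<close>, the functional equations of \<open>Ln\<close> and
    \<open>Digamma\<close> turn the increment into \<open>- T u\<close>.\<close>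
  have incr: "norm (g (v + 1) - g v) \<le> C0 * norm (1 / v) ^ (N + 2)"
    if v: "v \<in> slit_sector \<delta>" "norm v \<ge> c * R" for v
  proof -
    have v0: "v \<noteq> 0"
      using v by (auto simp: slit_sector_def)
    define u where "u = 1 / v"
    have "norm v > 1 / \<rho>"
      using v R by (smt (verit) norm_ge_zero)
    then have u: "u \<noteq> 0" "norm u < \<rho>"
      using v0 \<rho> by (auto simp: u_def norm_divide field_simps)
    then have "1 + u \<noteq> 0"
      using \<rho> by (metis add_eq_0_iff norm_minus_cancel norm_one not_less)
    moreover have "Im (Ln v) = Arg v"
      using v0 by (simp add: Arg_eq_Im_Ln)
    moreover have "\<bar>Im (Ln (1 + u))\<bar> < \<delta>"
      using \<rho>'(2)[of u] u \<rho> by auto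
    ultimately have "Ln (v * (1 + u)) = Ln v + Ln (1 + u)"
      using v v0 by (intro Ln_times_simple) (auto simp: slit_sector_def)
    moreover have vu: "v * (1 + u) = v + 1"
      using v0 by (simp add: u_def field_simps)
    ultimately have Ln: "Ln (v + 1) = Ln v + Ln (1 + u)"
      by simp
    have "norm v > norm x + 1"
      using v R \<rho> by (smt (verit) zero_le_divide_1_iff)
    then have "v + 1 - x \<noteq> 0"
      using norm_triangle_ineq4[of x 1] by (smt (verit) add_diff_eq eq_iff_diff_eq_0 minus_diff_eq norm_minus_cancel norm_one add_eq_0_iff2)
    then have "Digamma (v + 1 - x + 1) = Digamma (v + 1 - x) + 1 / (v + 1 - x)"
      by (rule Digamma_plus1)
    moreover have "v + 1 - x = v * (1 + (1 - x) * u)"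
      using v0 by (simp add: u_def field_simps)
    then have "1 / (v + 1 - x) = u / (1 + (1 - x) * u)"
      by (simp add: u_def)
    moreover have "v + 1 - x + 1 = (v + 1) + 1 - x"
      by simp
    ultimately have Digamma: "Digamma ((v + 1) + 1 - x) = Digamma (v + 1 - x) + u / (1 + (1 - x) * u)"
      by simp
    have inv: "1 / (v + 1) = u / (1 + u)" "1 / v = u"
      by (simp_all add: vu[symmetric] u_def)
    have "g (v + 1) - g v = - T u"
      unfolding g_def T_def Ln Digamma inv by (simp add: right_diff_distrib sum_subtractf)
    then show ?thesis
      using \<rho>'(2)[of u] u \<rho> unfolding inv by simp
  qed

  have "summable (\<lambda>n. inverse (real (Suc n) ^ 2))"
    using inverse_power_summable[of 2, where 'a = real] by (subst summable_Suc_iff) simp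
  define K where "K = (\<Sum>n. inverse (real (Suc n) ^ 2))"
  define C where "C = C0 * (1 / c) ^ (N + 2) * K"
  have partial: "(\<Sum>n<m. inverse (real (Suc n) ^ 2)) \<le> K" for m
    unfolding K_def by (rule sum_le_suminf) (use \<open>summable _\<close> in auto)
  have "C \<ge> 0"
    using partial[of 0] c C0 by (simp add: C_def)
  moreover have "norm (g w) \<le> C * norm (1 / w) ^ N" if w: "w \<in> slit_sector \<delta>" "norm w \<ge> R" for w
  proof -
    define a where "a = norm w"
    have a: "a \<ge> 1" "a \<ge> R" using w R by (auto simp: a_def)
    have wn: "w + of_nat n \<in> slit_sector \<delta>" "norm (w + of_nat n) \<ge> c * (a + n)"
      "norm (w + of_nat n) \<ge> c * R" for n
    proof -
      show "w + of_nat n \<in> slit_sector \<delta>" "norm (w + of_nat n) \<ge> c * (a + n)"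
        using shift[OF w(1), of "real n"] lower[OF w(1), of "real n"] by (auto simp: a_def)
      moreover have "c * R \<le> c * (a + n)"
        using a c by (intro mult_left_mono) auto
      ultimately show "norm (w + of_nat n) \<ge> c * R"
        by linarith
    qed
    have step: "norm (g (w + of_nat (Suc n)) - g (w + of_nat n))
        \<le> C0 * (1 / c) ^ (N + 2) * (1 / a) ^ N * inverse (real (Suc n) ^ 2)" for n
    proof -
      have "norm (1 / (w + of_nat n)) ^ (N + 2) \<le> (1 / (c * (a + n))) ^ (N + 2)"
      proof (rule power_mono)
        have "0 < c * (a + n)"
          using a c by simp
        then show "norm (1 / (w + of_nat n)) \<le> 1 / (c * (a + n))"
          unfolding norm_divide norm_one by (intro frac_le wn(2)) auto
      qed simp
      also have "\<dots> = (1 / c) ^ (N + 2) * ((1 / (a + n)) ^ N * (1 / (a + n)) ^ 2)"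
        by (simp add: power_add power_divide power_mult_distrib power2_eq_square)
      \<comment> \<open>\<open>N\<close> factors use \<open>a + n \<ge> a\<close>; the other two use
        \<open>a + n \<ge> n + 1\<close>, which needs \<open>a \<ge> 1\<close>.\<close>
      also have "\<dots> \<le> (1 / c) ^ (N + 2) * ((1 / a) ^ N * (1 / (Suc n)) ^ 2)"
        using a c by (intro mult_left_mono mult_mono power_mono divide_left_mono mult_pos_pos) auto
      finally have "C0 * norm (1 / (w + of_nat n)) ^ (N + 2) \<le>
          C0 * ((1 / c) ^ (N + 2) * ((1 / a) ^ N * (1 / (Suc n)) ^ 2))"
        using C0 by (intro mult_left_mono) auto
      then show ?thesis
        using incr[OF wn(1) wn(3), of n] by (simp add: field_simps)
    qed
    have bound: "norm (g (w + of_nat m) - g w) \<le> C * (1 / a) ^ N" for m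
    proof -
      have "g (w + of_nat m) - g w = (\<Sum>n<m. g (w + of_nat (Suc n)) - g (w + of_nat n))"
        using sum_lessThan_telescope[of "\<lambda>n. g (w + of_nat n)" m] by simp
      also have "norm \<dots> \<le> (\<Sum>n<m. C0 * (1 / c) ^ (N + 2) * (1 / a) ^ N * inverse (real (Suc n) ^ 2))"
        by (intro sum_norm_le step)
      also have "\<dots> = C0 * (1 / c) ^ (N + 2) * (1 / a) ^ N * (\<Sum>n<m. inverse (real (Suc n) ^ 2))"
        by (simp only: sum_distrib_left)
      also have "\<dots> \<le> C0 * (1 / c) ^ (N + 2) * (1 / a) ^ N * K"
        using C0 c a by (intro mult_left_mono partial) auto
      finally show ?thesis by (simp add: C_def mult_ac)
    qed
    have "(\<lambda>n. g (w + of_nat n)) \<longlonglongrightarrow> 0"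
    proof -
      have nz: "w + of_nat n \<noteq> 0" for n
        using wn(1)[of n] by (auto simp: slit_sector_def)
      have nz': "w + 1 - x + of_nat n \<noteq> 0" for n
      proof
        assume "w + 1 - x + of_nat n = 0"
        then have "w + of_nat n = x - 1" by (simp add: algebra_simps eq_neg_iff_add_eq_0)
        then have "norm (w + of_nat n) \<le> norm x + 1"
          using norm_triangle_ineq4[of x 1] by simp
        moreover have "1 / \<rho> > 0" using \<rho> by simp
        ultimately show False
          using wn(3)[of n] R by linarith
      qed
      have "filterlim (\<lambda>n. of_nat n + w) at_infinity sequentially"
        by (rule tendsto_add_filterlim_at_infinity'[OF tendsto_of_nat tendsto_const])
      then have "(\<lambda>n. 1 / (w + of_nat n)) \<longlonglongrightarrow> 0"
        by (intro tendsto_divide_0[OF tendsto_const]) (simp add: add.commute)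
      then have "(\<lambda>n. (Digamma (w + 1 - x + of_nat n) - of_real (ln (real n)))
          - (Ln (w + of_nat n) - of_real (ln (real n)))
          + (\<Sum>r\<in>{1..Suc N}. b r * (1 / (w + of_nat n)) ^ r)) \<longlonglongrightarrow> 0 - 0 + (\<Sum>r\<in>{1..Suc N}. b r * 0 ^ r)"
        by (intro tendsto_add tendsto_diff tendsto_sum tendsto_mult tendsto_const tendsto_power
            Digamma_shift_minus_ln_tendsto Ln_shift_minus_ln_tendsto nz nz')
      moreover have "(\<Sum>r\<in>{1..Suc N}. b r * 0 ^ r) = 0"
        by (intro sum.neutral) auto
      ultimately show ?thesis
        by (simp add: g_def algebra_simps)
    qed
    \<comment> \<open>The bound on the telescoped difference is uniform in the number of steps, so
      it passes to the limit, where only \<open>g w\<close> remains.\<close>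
    then have "(\<lambda>n. norm (g (w + of_nat n) - g w)) \<longlonglongrightarrow> norm (0 - g w)"
      by (intro tendsto_intros)
    then have "norm (0 - g w) \<le> C * (1 / a) ^ N"
      by (rule LIMSEQ_le_const2) (use bound in auto)
    then show ?thesis
      by (simp add: a_def norm_divide)
  qed
  ultimately show ?thesis
    using R that[of C R] by (auto simp: g_def b_def)
qed

section \<open>Zagier polynomials as expansion coefficients\<close>

text \<open>The r-th power contributes \<open>(n + r - 1) choose (2 * r - 1)\<close> in degree
  \<open>n\<close>; divided by \<open>2 * r\<close> this is
  \<open>((n + r) choose (2 * r)) / (n + r)\<close>. The logarithm supplies the summand
  \<open>1 / n\<close> for \<open>r = 0\<close>. Since \<open>N \<le> Suc M\<close>, the sum
  contains every \<open>r\<close> that affects degrees below \<open>N\<close>.\<close>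

lemma zagier_gen_fun_bigo:
  fixes x :: complex
  assumes "N \<le> Suc M"
  shows "(\<lambda>z. - ln (1 - z) + (1 / 2) * (\<Sum>r\<in>{1..M}. bernoulli_poly r x / of_nat r * (z / (1 - z) ^ 2) ^ r)
            - (\<Sum>n<N. zagier_gen_fun x $ n * z ^ n)) \<in> O[at 0](\<lambda>z. z ^ N)"
proof -
  \<comment> \<open>The factor 1/2 in front of the sum is absorbed into the denominator.\<close>
  define b where "b r = bernoulli_poly r x / of_nat (2 * r)" for r
  define Q where "Q r = Abs_fps (\<lambda>n. if n < r then 0
      else of_nat ((2 * r + (n - r) - 1) choose (n - r)) * 1 ^ (n - r) :: complex)" for r
  define H where "H z = - ln (1 - z) + (\<Sum>r\<in>{1..M}. b r * (z ^ r * inverse ((1 - 1 * z) ^ (2 * r))))" for z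
  define F where "F = - Abs_fps (\<lambda>n. - 1 / of_nat n) + (\<Sum>r\<in>{1..M}. fps_const (b r) * Q r)"
  have "H has_fps_expansion F"
    unfolding H_def F_def Q_def
    by (intro has_fps_expansion_add has_fps_expansion_minus has_fps_expansion_ln_one_minus
        has_fps_expansion_sum has_fps_expansion_cmult_left has_fps_expansion_power_quotient) auto
  then have "(\<lambda>z. H z - (\<Sum>n<N. F $ n * z ^ n)) \<in> O[at 0](\<lambda>z. z ^ N)"
    by (rule has_fps_expansion_imp_bigo)
  moreover have "F $ n = zagier_gen_fun x $ n" if "n < N" for n
  proof (cases "n = 0")
    case True
    then show ?thesis
      by (auto simp: F_def Q_def zagier_gen_fun_def fps_sum_nth intro!: sum.neutral)
  next
    case n: False
    have "F $ n = 1 / of_nat n + (\<Sum>r\<in>{1..M}. b r * Q r $ n)"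
      by (simp add: F_def fps_sum_nth)
    also have "(\<Sum>r\<in>{1..M}. b r * Q r $ n) = (\<Sum>r\<in>{1..n}. b r * Q r $ n)"
      using \<open>n < N\<close> assms by (intro sum.mono_neutral_right) (auto simp: Q_def)
    also have "\<dots> = (\<Sum>r\<in>{1..n}. of_nat ((n + r) choose (2 * r)) * (bernoulli_poly r x / of_nat (n + r)))"
    proof (intro sum.cong refl)
      fix r assume r: "r \<in> {1..n}"
      have top: "2 * r + (n - r) - 1 = n + r - 1"
        using r by auto
      have lower: "(n + r - 1) choose (n - r) = (n + r - 1) choose (2 * r - 1)"
        using r binomial_symmetric[of "n - r" "n + r - 1"] by (auto simp: mult_2)
      have "2 * r * ((n + r) choose (2 * r)) = (n + r) * ((n + r - 1) choose (2 * r - 1))"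
        using r by (intro times_binomial_minus1_eq) auto
      then have "of_nat (2 * r) * of_nat ((n + r) choose (2 * r)) =
          (of_nat (n + r) * of_nat ((n + r - 1) choose (2 * r - 1)) :: complex)"
        by (metis of_nat_mult)
      moreover have nz: "of_nat (2 * r) \<noteq> (0 :: complex)" "of_nat (n + r) \<noteq> (0 :: complex)"
        using r by (auto simp del: of_nat_add of_nat_mult)
      ultimately have quot: "of_nat ((n + r - 1) choose (2 * r - 1)) / of_nat (2 * r) =
          (of_nat ((n + r) choose (2 * r)) / of_nat (n + r) :: complex)"
        unfolding frac_eq_eq[OF nz] by (simp only: mult.commute)
      have "Q r $ n = of_nat ((n + r - 1) choose (2 * r - 1))"
        using r unfolding Q_def fps_nth_Abs_fps top lower by simp
      then have eq: "b r * Q r $ n =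
          bernoulli_poly r x * (of_nat ((n + r - 1) choose (2 * r - 1)) / of_nat (2 * r))"
        by (simp only: b_def times_divide_eq_left times_divide_eq_right)
      show "b r * Q r $ n = of_nat ((n + r) choose (2 * r)) * (bernoulli_poly r x / of_nat (n + r))"
        unfolding eq quot by (simp only: times_divide_eq_left times_divide_eq_right mult.commute)
    qed
    also have "1 / of_nat n + \<dots> = zagier_poly n x"
      using n by (simp add: zagier_poly_def sum.atLeast_Suc_atMost)
    finally show ?thesis
      using n by (simp add: zagier_gen_fun_def)
  qed
  moreover have "b r * (z ^ r * inverse ((1 - 1 * z) ^ (2 * r))) =
      (1 / 2) * (bernoulli_poly r x / of_nat r * (z / (1 - z) ^ 2) ^ r)" for r z
  proof -
    have "(1 - 1 * z) ^ (2 * r) = ((1 - z) ^ 2) ^ r"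
      by (simp only: mult_1_left power_mult)
    then show ?thesis
      by (simp only: b_def power_mult_distrib power_inverse of_nat_mult of_nat_numeral divide_inverse
          inverse_mult_distrib mult_1_left mult_ac)
  qed
  then have "H = (\<lambda>z. - ln (1 - z) + (1 / 2) * (\<Sum>r\<in>{1..M}. bernoulli_poly r x / of_nat r * (z / (1 - z) ^ 2) ^ r))"
    unfolding H_def sum_distrib_left by (intro ext) simp
  ultimately show ?thesis
    by simp
qed

section \<open>Substitution into the digamma expansion\<close>

theorem theorem5p1:
  fixes x :: complex and \<delta> :: real
  assumes "0 < \<delta>" and "\<delta> < pi"
  shows "has_asymptotic_series
           (\<lambda>z. - (1/2) * ln z - (1/2) * Digamma (z + 1 / z - 1 - x))
           (zagier_gen_fun x) (slit_sector \<delta>)"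
  unfolding has_asymptotic_series_def
proof
  fix N :: nat
  let ?A = "at 0 within slit_sector \<delta>"
  define S where "S u = (\<Sum>r\<in>{1..Suc N}. bernoulli_poly r x / of_nat r * u ^ r)" for u
  define f where "f z = - (1/2) * ln z - (1/2) * Digamma (z + 1 / z - 1 - x)" for z
  \<comment> \<open>\<open>H\<close> is what \<open>f\<close> becomes when
    \<open>Digamma (w + 1 - x)\<close> is replaced by \<open>Ln w - S (1 / w)\<close> at
    \<open>w = W z\<close>; the two halves of \<open>Ln z\<close> cancel.\<close>
  define H where "H z = - ln (1 - z) + (1 / 2) * S (z / (1 - z) ^ 2)" for z
  define W where "W z = (1 - z) ^ 2 / z" for z :: complex
  \<comment> \<open>The factor \<open>(1 - z) ^ 2\<close> may turn \<open>W z\<close> slightly out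
    of the sector of angle \<open>\<delta>\<close>; half of \<open>\<delta>\<close> is reserved for
    it, hence \<open>\<delta> / 4\<close> for \<open>1 - z\<close> below.\<close>
  obtain C R where CR: "C \<ge> 0" "R > 0"
    and bound: "\<And>w. w \<in> slit_sector (\<delta> / 2) \<Longrightarrow> norm w \<ge> R \<Longrightarrow>
           norm (Digamma (w + 1 - x) - (Ln w - S (1 / w))) \<le> C * norm (1 / w) ^ N"
    using Digamma_asymptotic_expansion[of "\<delta> / 2" x N] assms unfolding S_def by auto

  have le: "?A \<le> at 0"
    by (rule at_le) simp
  have "((\<lambda>z. Im (Ln (1 - z))) \<longlongrightarrow> Im (Ln (1 - 0))) (at 0)"
    by (intro tendsto_intros) auto
  then have "\<forall>\<^sub>F z in at 0. dist (Im (Ln (1 - z))) 0 < \<delta> / 4"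
    using assms by (intro tendstoD) auto
  \<comment> \<open>\<open>norm z < 1 / 2\<close> yields
    \<open>norm (1 / W z) \<le> 4 * norm z\<close>, and then \<open>norm z < 1 / (4 * R)\<close>
    forces \<open>norm (W z) \<ge> R\<close>.\<close>
  moreover have "\<forall>\<^sub>F z in at 0. z \<in> ball 0 (min (1 / 2) (1 / (4 * R)))"
    using CR by (intro eventually_at_in_open') auto
  ultimately have "\<forall>\<^sub>F z in at 0. \<bar>Im (Ln (1 - z))\<bar> < \<delta> / 4 \<and> norm z < 1 / 2 \<and> norm z < 1 / (4 * R)"
    by eventually_elim auto
  then have "\<forall>\<^sub>F z in ?A. \<bar>Im (Ln (1 - z))\<bar> < \<delta> / 4 \<and> norm z < 1 / 2 \<and> norm z < 1 / (4 * R)"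
    by (rule filter_leD[OF le])
  moreover have "\<forall>\<^sub>F z in ?A. z \<in> slit_sector \<delta>"
    by (auto simp: eventually_at_filter)
  ultimately have "\<forall>\<^sub>F z in ?A. norm (f z - H z) \<le> C / 2 * 4 ^ N * norm (z ^ N)"
  proof eventually_elim
    case (elim z)
    have z: "z \<noteq> 0" "norm z < 1 / 2" "norm z * (4 * R) < 1"
      using elim CR by (auto simp: slit_sector_def field_simps)
    have z1: "norm (1 - z) \<ge> 1 / 2"
      using norm_triangle_ineq2[of 1 z] z by simp
    then have z1': "1 - z \<noteq> 0"
      by auto
    have inv: "1 / W z = z / (1 - z) ^ 2"
      by (simp add: W_def)
    have "norm (1 / W z) \<le> norm z / (1 / 2) ^ 2"
      unfolding inv norm_divide norm_power using z1 by (intro frac_le power_mono) auto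
    then have small: "norm (1 / W z) \<le> 4 * norm z"
      by (simp add: power2_eq_square)
    have W0: "W z \<noteq> 0"
      using z z1' by (simp add: W_def)
    have "norm (1 / W z) * R \<le> 1"
      using mult_right_mono[OF small less_imp_le[OF CR(2)]] z(3) by linarith
    then have "norm (W z) \<ge> R"
      using W0 by (simp add: norm_divide field_simps)
    have "\<bar>Im (Ln z)\<bar> \<le> pi - \<delta>" "\<bar>Im (Ln (1 - z))\<bar> < \<delta> / 4"
      using elim z by (auto simp: slit_sector_def Arg_eq_Im_Ln)
    then have Im_Ln: "\<bar>Im (2 * Ln (1 - z) - Ln z)\<bar> \<le> pi - \<delta> / 2"
      by simp
    \<comment> \<open>The candidate has the right exponential, and its imaginary part lies in the
      principal strip.\<close>
    have Ln_W: "Ln (W z) = 2 * Ln (1 - z) - Ln z"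
    proof (rule Ln_unique)
      show "exp (2 * Ln (1 - z) - Ln z) = W z"
        using z z1' by (simp add: exp_diff exp_double W_def)
    qed (use Im_Ln assms in linarith)+
    then have "W z \<in> slit_sector (\<delta> / 2)"
      using Im_Ln W0 by (simp add: slit_sector_def Arg_eq_Im_Ln)
    have arg: "z + 1 / z - 1 - x = W z + 1 - x"
      using z by (simp add: W_def power2_eq_square field_simps)
    have "f z - H z = - (1 / 2) * (Digamma (W z + 1 - x) - (Ln (W z) - S (1 / W z)))"
      unfolding f_def H_def Ln_W inv arg by (simp add: field_simps)
    also have "norm \<dots> \<le> 1 / 2 * (C * norm (1 / W z) ^ N)"
      using bound[OF \<open>W z \<in> _\<close> \<open>norm (W z) \<ge> R\<close>] by (simp add: norm_mult)
    also have "\<dots> \<le> 1 / 2 * (C * (4 * norm z) ^ N)"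
      using small CR by (intro mult_left_mono power_mono) auto
    finally show ?case
      by (simp add: norm_power power_mult_distrib)
  qed
  then have "(\<lambda>z. f z - H z) \<in> O[?A](\<lambda>z. z ^ N)"
    by (rule bigoI)
  moreover have "(\<lambda>z. H z - (\<Sum>n<N. zagier_gen_fun x $ n * z ^ n)) \<in> O[?A](\<lambda>z. z ^ N)"
    using zagier_gen_fun_bigo[of N "Suc N" x] unfolding H_def S_def
    by (intro landau_o.big.filter_mono[OF le]) simp
  ultimately have "(\<lambda>z. (f z - H z) + (H z - (\<Sum>n<N. zagier_gen_fun x $ n * z ^ n))) \<in> O[?A](\<lambda>z. z ^ N)"
    by (rule sum_in_bigo)
  then show "(\<lambda>z. - (1/2) * ln z - (1/2) * Digamma (z + 1 / z - 1 - x)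
      - (\<Sum>n<N. zagier_gen_fun x $ n * z ^ n)) \<in> O[?A](\<lambda>z. z ^ N)"
    by (simp only: f_def add_diff_eq diff_add_cancel)
qed

end
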